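(* Let $L=Fx+H$ be a finite dimensional Lie algebra over a field $F$, where $x\in L$ and $H$ is an ideal in $L$. Then $Sz(U(H))$ is $\mathrm{ad}x$ stable if and only if $U(H)_\lambda$ is $\mathrm{ad}x$ stable for every linear form $\lambda:H\to F$.
   Context: $U(H)$ is the enveloping algebra of $H$, regarded as a subalgebra of the enveloping algebra $U(L)$ of $L$. For a linear form $\lambda:H\to F$, the weight space is $U(H)_\lambda=\{u\in U(H) : [h,u]=\lambda(h)u \text{ for all } h\in H\}$. The sum of all the weight spaces $U(H)_\lambda$, over all linear forms $\lambda$ on $H$, is direct and is denoted $Sz(U(H))$, the semi-center of $U(H)$. A subspace $W\subseteq U(H)$ is called $\mathrm{ad}x$ stable if $[x,W]\subseteq W$, where the bracket is the commutator in $U(L)$. *)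

theory Defs
  imports "HOL.Vector_Spaces" "HOL-Algebra.QuotRing" "HOL-Library.Poly_Mapping"
begin

locale lie_algebra = vector_space scale
  for scale :: "'f::field \<Rightarrow> 'l::ab_group_add \<Rightarrow> 'l" +
  fixes br :: "'l \<Rightarrow> 'l \<Rightarrow> 'l"
  assumes linear_br_left: "Vector_Spaces.linear scale scale (\<lambda>a. br a b)"
    and linear_br_right: "Vector_Spaces.linear scale scale (br a)"
    and br_self: "br a a = 0"
    and jacobi: "br a (br b c) + br b (br c a) + br c (br a b) = 0"

definition lie_ideal ::
  "('f::field \<Rightarrow> 'l::ab_group_add \<Rightarrow> 'l) \<Rightarrow> ('l \<Rightarrow> 'l \<Rightarrow> 'l) \<Rightarrow> 'l set \<Rightarrow> bool"
  where "lie_ideal scale br H \<longleftrightarrow>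
    module.subspace scale H \<and> (\<forall>y. \<forall>h\<in>H. br y h \<in> H)"

text \<open>
  The dual space of a subspace \<open>H\<close>. Forms are total functions that are
  \<open>undefined\<close> outside \<open>H\<close>, so that distinct elements are distinct forms on \<open>H\<close>.
\<close>

definition linear_forms :: "('f::field \<Rightarrow> 'l::ab_group_add \<Rightarrow> 'l) \<Rightarrow> 'l set \<Rightarrow> ('l \<Rightarrow> 'f) set"
  where "linear_forms scale H = {\<mu> \<in> extensional H.
    (\<forall>a\<in>H. \<forall>b\<in>H. \<mu> (a + b) = \<mu> a + \<mu> b) \<and>
    (\<forall>c. \<forall>a\<in>H. \<mu> (scale c a) = c * \<mu> a)}"

text \<open>
  Words form the free monoid under concatenation (written additively, as required by
  \<^type>\<open>poly_mapping\<close>), so \<open>'l fword \<Rightarrow>\<^sub>0 'f\<close> with its convolution product is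
  the free associative unital \<open>'f\<close>-algebra on \<open>'l\<close>.
\<close>

datatype 'l fword = Fword (letters: "'l list")

instantiation fword :: (type) monoid_add
begin

definition zero_fword :: "'a fword" where "zero_fword = Fword []"

definition plus_fword :: "'a fword \<Rightarrow> 'a fword \<Rightarrow> 'a fword"
  where "plus_fword v w = Fword (letters v @ letters w)"

instance
  by standard (simp_all add: zero_fword_def plus_fword_def)

end

definition var :: "'l \<Rightarrow> 'l fword \<Rightarrow>\<^sub>0 'f::field"
  where "var a = Poly_Mapping.single (Fword [a]) 1"

definition const :: "'f::field \<Rightarrow> 'l fword \<Rightarrow>\<^sub>0 'f"
  where "const c = Poly_Mapping.single 0 c"

definition free_algebra :: "'l set \<Rightarrow> ('l fword \<Rightarrow>\<^sub>0 'f::field) ring"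
  where "free_algebra K =
    \<lparr>carrier = {p. \<forall>w\<in>Poly_Mapping.keys p. set (letters w) \<subseteq> K},
     monoid.mult = (*), one = 1, zero = 0, add = (+)\<rparr>"

text \<open>
  Let \<open>K\<close> be a Lie subalgebra. The first two families of relations turn the free algebra on
  the set \<open>K\<close> into the tensor algebra of the vector space \<open>K\<close>; the third one
  then gives the enveloping algebra.
\<close>

definition env_relations ::
  "('f::field \<Rightarrow> 'l::ab_group_add \<Rightarrow> 'l) \<Rightarrow> ('l \<Rightarrow> 'l \<Rightarrow> 'l) \<Rightarrow> 'l set \<Rightarrow> ('l fword \<Rightarrow>\<^sub>0 'f) set"
  where "env_relations scale br K =
    {var (a + b) - (var a + var b) | a b. a \<in> K \<and> b \<in> K} \<union>
    {var (scale c a) - const c * var a | c a. a \<in> K} \<union>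
    {(var a * var b - var b * var a) - var (br a b) | a b. a \<in> K \<and> b \<in> K}"

definition env_ideal ::
  "('f::field \<Rightarrow> 'l::ab_group_add \<Rightarrow> 'l) \<Rightarrow> ('l \<Rightarrow> 'l \<Rightarrow> 'l) \<Rightarrow> 'l set \<Rightarrow> ('l fword \<Rightarrow>\<^sub>0 'f) set"
  where "env_ideal scale br K = Idl\<^bsub>free_algebra K\<^esub> (env_relations scale br K)"

definition env ::
  "('f::field \<Rightarrow> 'l::ab_group_add \<Rightarrow> 'l) \<Rightarrow> ('l \<Rightarrow> 'l \<Rightarrow> 'l) \<Rightarrow> 'l set \<Rightarrow> ('l fword \<Rightarrow>\<^sub>0 'f) set ring"
  where "env scale br K = free_algebra K Quot env_ideal scale br K"

abbreviation envL ::
  "('f::field \<Rightarrow> 'l::ab_group_add \<Rightarrow> 'l) \<Rightarrow> ('l \<Rightarrow> 'l \<Rightarrow> 'l) \<Rightarrow> ('l fword \<Rightarrow>\<^sub>0 'f) set ring"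
  where "envL scale br \<equiv> env scale br UNIV"

definition env_class ::
  "('f::field \<Rightarrow> 'l::ab_group_add \<Rightarrow> 'l) \<Rightarrow> ('l \<Rightarrow> 'l \<Rightarrow> 'l) \<Rightarrow> 'l set \<Rightarrow>
    ('l fword \<Rightarrow>\<^sub>0 'f) \<Rightarrow> ('l fword \<Rightarrow>\<^sub>0 'f) set"
  where "env_class scale br K p = env_ideal scale br K +>\<^bsub>free_algebra K\<^esub> p"

text \<open>The canonical map \<open>L \<rightarrow> U(L)\<close>, through which elements of \<open>L\<close> act on \<open>U(L)\<close>.\<close>

definition env_emb ::
  "('f::field \<Rightarrow> 'l::ab_group_add \<Rightarrow> 'l) \<Rightarrow> ('l \<Rightarrow> 'l \<Rightarrow> 'l) \<Rightarrow> 'l \<Rightarrow> ('l fword \<Rightarrow>\<^sub>0 'f) set"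
  where "env_emb scale br a = env_class scale br UNIV (var a)"

definition env_scale ::
  "('f::field \<Rightarrow> 'l::ab_group_add \<Rightarrow> 'l) \<Rightarrow> ('l \<Rightarrow> 'l \<Rightarrow> 'l) \<Rightarrow>
    'f \<Rightarrow> ('l fword \<Rightarrow>\<^sub>0 'f) set \<Rightarrow> ('l fword \<Rightarrow>\<^sub>0 'f) set"
  where "env_scale scale br c u = env_class scale br UNIV (const c) \<otimes>\<^bsub>envL scale br\<^esub> u"

text \<open>
  The algebra homomorphism \<open>U(H) \<rightarrow> U(L)\<close> induced by the inclusion \<open>H \<subseteq> L\<close>: it
  enlarges a coset of the ideal defining \<open>U(H)\<close> to the coset of the ideal defining
  \<open>U(L)\<close> that contains it (see \<open>env_incl_class\<close> below). It is injective by the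
  Poincare-Birkhoff-Witt theorem, and \<open>U(H)\<close> is regarded as a subalgebra of
  \<open>U(L)\<close> by passing to its image.
\<close>

definition env_incl ::
  "('f::field \<Rightarrow> 'l::ab_group_add \<Rightarrow> 'l) \<Rightarrow> ('l \<Rightarrow> 'l \<Rightarrow> 'l) \<Rightarrow>
    ('l fword \<Rightarrow>\<^sub>0 'f) set \<Rightarrow> ('l fword \<Rightarrow>\<^sub>0 'f) set"
  where "env_incl scale br X = env_ideal scale br UNIV <+>\<^bsub>free_algebra UNIV\<^esub> X"

definition env_sub ::
  "('f::field \<Rightarrow> 'l::ab_group_add \<Rightarrow> 'l) \<Rightarrow> ('l \<Rightarrow> 'l \<Rightarrow> 'l) \<Rightarrow> 'l set \<Rightarrow> ('l fword \<Rightarrow>\<^sub>0 'f) set set"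
  where "env_sub scale br H = env_incl scale br ` carrier (env scale br H)"

definition env_ad ::
  "('f::field \<Rightarrow> 'l::ab_group_add \<Rightarrow> 'l) \<Rightarrow> ('l \<Rightarrow> 'l \<Rightarrow> 'l) \<Rightarrow>
    'l \<Rightarrow> ('l fword \<Rightarrow>\<^sub>0 'f) set \<Rightarrow> ('l fword \<Rightarrow>\<^sub>0 'f) set"
  where "env_ad scale br a u =
    (env_emb scale br a \<otimes>\<^bsub>envL scale br\<^esub> u) \<ominus>\<^bsub>envL scale br\<^esub> (u \<otimes>\<^bsub>envL scale br\<^esub> env_emb scale br a)"

definition weight_space ::
  "('f::field \<Rightarrow> 'l::ab_group_add \<Rightarrow> 'l) \<Rightarrow> ('l \<Rightarrow> 'l \<Rightarrow> 'l) \<Rightarrow> 'l set \<Rightarrow> ('l \<Rightarrow> 'f) \<Rightarrow>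
    ('l fword \<Rightarrow>\<^sub>0 'f) set set"
  where "weight_space scale br H \<mu> =
    {u \<in> env_sub scale br H. \<forall>h\<in>H. env_ad scale br h u = env_scale scale br (\<mu> h) u}"

definition semi_center ::
  "('f::field \<Rightarrow> 'l::ab_group_add \<Rightarrow> 'l) \<Rightarrow> ('l \<Rightarrow> 'l \<Rightarrow> 'l) \<Rightarrow> 'l set \<Rightarrow>
    ('l fword \<Rightarrow>\<^sub>0 'f) set set"
  where "semi_center scale br H =
    {finsum (envL scale br) v \<Lambda> | v \<Lambda>. finite \<Lambda> \<and> \<Lambda> \<subseteq> linear_forms scale H \<and>
      (\<forall>\<mu>\<in>\<Lambda>. v \<mu> \<in> weight_space scale br H \<mu>)}"

definition ad_stable ::
  "('f::field \<Rightarrow> 'l::ab_group_add \<Rightarrow> 'l) \<Rightarrow> ('l \<Rightarrow> 'l \<Rightarrow> 'l) \<Rightarrow> 'l \<Rightarrow>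
    ('l fword \<Rightarrow>\<^sub>0 'f) set set \<Rightarrow> bool"
  where "ad_stable scale br a W \<longleftrightarrow> (\<forall>w\<in>W. env_ad scale br a w \<in> W)"

lemma ring_free_algebra: "ring (free_algebra K :: ('l fword \<Rightarrow>\<^sub>0 'f::field) ring)"
proof (rule ringI)
  let ?R = "free_algebra K :: ('l fword \<Rightarrow>\<^sub>0 'f) ring"
  show "abelian_group ?R"
  proof (rule abelian_groupI)
    fix p q assume "p \<in> carrier ?R" "q \<in> carrier ?R"
    then show "p \<oplus>\<^bsub>?R\<^esub> q \<in> carrier ?R"
      using Poly_Mapping.keys_add[of p q] by (fastforce simp: free_algebra_def)
  next
    fix p assume "p \<in> carrier ?R"
    then show "\<exists>q\<in>carrier ?R. q \<oplus>\<^bsub>?R\<^esub> p = \<zero>\<^bsub>?R\<^esub>"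
      by (intro bexI[of _ "- p"]) (auto simp: free_algebra_def)
  qed (auto simp: free_algebra_def algebra_simps)
  show "Group.monoid ?R"
  proof (rule monoidI)
    fix p q assume pq: "p \<in> carrier ?R" "q \<in> carrier ?R"
    show "p \<otimes>\<^bsub>?R\<^esub> q \<in> carrier ?R"
      using pq keys_mult[of p q] by (fastforce simp: free_algebra_def plus_fword_def)
  next
    show "\<one>\<^bsub>?R\<^esub> \<in> carrier ?R"
      by (auto simp: free_algebra_def zero_fword_def)
  qed (auto simp: free_algebra_def algebra_simps)
qed (auto simp: free_algebra_def algebra_simps)

lemma carrier_free_algebra_UNIV [simp]: "carrier (free_algebra UNIV) = UNIV"
  by (auto simp: free_algebra_def)

lemma a_inv_free_algebra:
  assumes "p \<in> carrier (free_algebra K)"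
  shows "\<ominus>\<^bsub>free_algebra K\<^esub> p = - p"
proof -
  interpret ring "free_algebra K" by (rule ring_free_algebra)
  have "\<ominus>\<^bsub>free_algebra K\<^esub> p \<oplus>\<^bsub>free_algebra K\<^esub> p = \<zero>\<^bsub>free_algebra K\<^esub>"
    using assms by (rule l_neg)
  then show ?thesis by (simp add: free_algebra_def eq_neg_iff_add_eq_0)
qed

lemma minus_free_algebra:
  assumes "p \<in> carrier (free_algebra K)" "q \<in> carrier (free_algebra K)"
  shows "p \<ominus>\<^bsub>free_algebra K\<^esub> q = p - q"
  using assms by (simp add: a_minus_def a_inv_free_algebra) (simp add: free_algebra_def)

lemma var_in_carrier: "a \<in> K \<Longrightarrow> var a \<in> carrier (free_algebra K)"
  and const_in_carrier: "const c \<in> carrier (free_algebra K)"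
  by (auto simp: free_algebra_def var_def const_def zero_fword_def)

lemma env_relations_subset:
  assumes "module.subspace scale K" "\<And>a b. a \<in> K \<Longrightarrow> b \<in> K \<Longrightarrow> br a b \<in> K" "vector_space scale"
  shows "env_relations scale br K \<subseteq> carrier (free_algebra K)"
proof -
  let ?R = "free_algebra K"
  interpret vector_space scale by fact
  interpret R: ring ?R by (rule ring_free_algebra)
  have add: "p + q \<in> carrier ?R" and mult: "p * q \<in> carrier ?R" and minus: "p - q \<in> carrier ?R"
    if "p \<in> carrier ?R" "q \<in> carrier ?R" for p q :: "'b fword \<Rightarrow>\<^sub>0 'a"
    using R.a_closed[OF that] R.m_closed[OF that]
      R.minus_closed[OF that, unfolded minus_free_algebra[OF that]]
    by (simp_all add: free_algebra_def)
  show ?thesis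
    using assms(1,2) subspace_add[OF assms(1)] subspace_scale[OF assms(1)]
    by (auto simp: env_relations_def intro!: minus add mult var_in_carrier const_in_carrier)
qed

lemma (in lie_algebra) ideal_env_ideal:
  assumes "subspace K" "\<And>a b. a \<in> K \<Longrightarrow> b \<in> K \<Longrightarrow> br a b \<in> K"
  shows "ideal (env_ideal scale br K) (free_algebra K)"
  unfolding env_ideal_def
  using assms by (intro ring.genideal_ideal ring_free_algebra env_relations_subset vector_space_axioms) auto

lemma (in lie_algebra) ring_env:
  assumes "subspace K" "\<And>a b. a \<in> K \<Longrightarrow> b \<in> K \<Longrightarrow> br a b \<in> K"
  shows "ring (env scale br K)"
  unfolding env_def by (rule ideal.quotient_is_ring[OF ideal_env_ideal[OF assms]])

lemma (in lie_algebra) env_ideal_mono: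
  assumes "subspace K" "\<And>a b. a \<in> K \<Longrightarrow> b \<in> K \<Longrightarrow> br a b \<in> K"
  shows "env_ideal scale br K \<subseteq> env_ideal scale br UNIV"
proof -
  let ?I = "env_ideal scale br UNIV" and ?R = "free_algebra K :: ('l fword \<Rightarrow>\<^sub>0 'f) ring"
  interpret U: ideal ?I "free_algebra UNIV" by (rule ideal_env_ideal) auto
  note U_sub = U.additive_subgroup_axioms
  interpret R: ring ?R by (rule ring_free_algebra)
  have sub: "env_relations scale br K \<subseteq> carrier ?R"
    using assms by (intro env_relations_subset vector_space_axioms) auto
  have "env_relations scale br UNIV \<subseteq> ?I"
    unfolding env_ideal_def by (intro ring.genideal_self ring_free_algebra) simp
  moreover have "env_relations scale br K \<subseteq> env_relations scale br UNIV"
    unfolding env_relations_def by (intro Un_mono) blast+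
  ultimately have rel: "env_relations scale br K \<subseteq> ?I" by blast
  have "ideal (?I \<inter> carrier ?R) ?R"
  proof (rule idealI)
    show "subgroup (?I \<inter> carrier ?R) (add_monoid ?R)"
    proof (rule R.add.subgroupI)
      fix p assume p: "p \<in> ?I \<inter> carrier ?R"
      then have "- p \<in> ?I"
        using additive_subgroup.a_inv_closed[OF U_sub, of p] by (simp add: a_inv_free_algebra)
      then show "\<ominus>\<^bsub>?R\<^esub> p \<in> ?I \<inter> carrier ?R"
        using p R.a_inv_closed[of p] by (simp add: a_inv_free_algebra)
    next
      show "?I \<inter> carrier ?R \<noteq> {}"
        using additive_subgroup.zero_closed[OF U_sub] R.zero_closed by (auto simp: free_algebra_def)
    next
      fix p q assume "p \<in> ?I \<inter> carrier ?R" "q \<in> ?I \<inter> carrier ?R"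
      then show "p \<oplus>\<^bsub>?R\<^esub> q \<in> ?I \<inter> carrier ?R"
        using additive_subgroup.a_closed[OF U_sub, of p q] R.a_closed[of p q] by (simp add: free_algebra_def)
    qed simp
  next
    fix p q assume "p \<in> ?I \<inter> carrier ?R" "q \<in> carrier ?R"
    then show "q \<otimes>\<^bsub>?R\<^esub> p \<in> ?I \<inter> carrier ?R" "p \<otimes>\<^bsub>?R\<^esub> q \<in> ?I \<inter> carrier ?R"
      using U.I_l_closed[of p q] U.I_r_closed[of p q] R.m_closed[of p q] R.m_closed[of q p]
      by (simp_all add: free_algebra_def)
  qed (rule ring_free_algebra)
  then have "env_ideal scale br K \<subseteq> ?I \<inter> carrier ?R"
    unfolding env_ideal_def[of _ _ K] using rel sub by (intro R.genideal_minimal) auto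
  then show ?thesis by blast
qed

lemma (in lie_algebra) env_incl_class:
  assumes "subspace K" "\<And>a b. a \<in> K \<Longrightarrow> b \<in> K \<Longrightarrow> br a b \<in> K"
    and "p \<in> carrier (free_algebra K)"
  shows "env_incl scale br (env_class scale br K p) = env_class scale br UNIV p"
proof -
  let ?I = "env_ideal scale br UNIV" and ?J = "env_ideal scale br K"
  interpret U: ideal ?I "free_algebra UNIV" by (rule ideal_env_ideal) auto
  note U_sub = U.additive_subgroup_axioms
  interpret J: ideal ?J "free_algebra K" by (rule ideal_env_ideal[OF assms(1,2)])
  have sub: "?J \<subseteq> ?I" by (rule env_ideal_mono[OF assms(1,2)])
  have add: "i + j \<in> ?I" if "i \<in> ?I" "j \<in> ?I" for i j
    using additive_subgroup.a_closed[OF U_sub that] by (simp add: free_algebra_def)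
  have zero: "0 \<in> ?J" using additive_subgroup.zero_closed[OF J.additive_subgroup_axioms] by (simp add: free_algebra_def)
  have "env_incl scale br (env_class scale br K p) = {i + (j + p) | i j. i \<in> ?I \<and> j \<in> ?J}"
    unfolding env_incl_def env_class_def set_add_def' a_r_coset_def' free_algebra_def ring.simps
    by blast
  also have "\<dots> = {i + p | i. i \<in> ?I}"
  proof (intro equalityI subsetI)
    fix y assume "y \<in> {i + (j + p) | i j. i \<in> ?I \<and> j \<in> ?J}"
    then obtain i j where "y = (i + j) + p" "i \<in> ?I" "j \<in> ?J" by (auto simp: add.assoc)
    then show "y \<in> {i + p | i. i \<in> ?I}" using add sub by blast
  next
    fix y assume "y \<in> {i + p | i. i \<in> ?I}"
    then obtain i where "y = i + (0 + p)" "i \<in> ?I" by auto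
    then show "y \<in> {i + (j + p) | i j. i \<in> ?I \<and> j \<in> ?J}" using zero by blast
  qed
  also have "\<dots> = env_class scale br UNIV p"
    unfolding env_class_def a_r_coset_def' free_algebra_def ring.simps by blast
  finally show ?thesis .
qed

lemma (in lie_algebra) env_sub_eq:
  assumes "subspace K" "\<And>a b. a \<in> K \<Longrightarrow> b \<in> K \<Longrightarrow> br a b \<in> K"
  shows "env_sub scale br K = env_class scale br UNIV ` carrier (free_algebra K)"
proof -
  have "carrier (env scale br K) = env_class scale br K ` carrier (free_algebra K)"
    by (auto simp: env_def FactRing_def A_RCOSETS_def' env_class_def)
  then show ?thesis
    unfolding env_sub_def by (simp add: image_image env_incl_class[OF assms] cong: image_cong)
qed

end

theory Submission
  imports Defs
begin

text \<open>
  For \<open>u\<close> of weight \<open>\<kappa>\<close> and \<open>h \<in> H\<close>, the Jacobi identity gives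
  \<open>[h, [x, u]] - \<kappa>(h) [x, u] = - \<kappa>([x, h]) u\<close>. If \<open>[x, u]\<close> is a sum of weight vectors
  \<open>v\<^sub>\<mu>\<close>, the left-hand side is the sum of the \<open>(\<mu>(h) - \<kappa>(h)) v\<^sub>\<mu>\<close>, in which the term of
  weight \<open>\<kappa>\<close> vanishes. Since the right-hand side has weight \<open>\<kappa>\<close>, independence of the weight
  spaces forces \<open>v\<^sub>\<mu> = 0\<close> for \<open>\<mu> \<noteq> \<kappa>\<close>, so \<open>[x, u]\<close> has weight \<open>\<kappa>\<close>.
\<close>

text \<open>Eigenvector relations and the sum are only required modulo an invariant subspace
  \<open>I\<close>. This gives independence of weight spaces in the quotient by \<open>I\<close>
  while all vectors stay in the ambient space. The proof is the usual induction that eliminates one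
  weight at a time.\<close>

lemma (in vector_space) weight_vectors_independent_mod:
  assumes I: "subspace I"
    and lin: "\<And>h. h \<in> H \<Longrightarrow> Vector_Spaces.linear scale scale (D h)"
    and inv: "\<And>h u. h \<in> H \<Longrightarrow> u \<in> I \<Longrightarrow> D h u \<in> I"
    and "finite \<Lambda>"
    and "\<And>\<mu> \<nu>. \<mu> \<in> \<Lambda> \<Longrightarrow> \<nu> \<in> \<Lambda> \<Longrightarrow> \<mu> \<noteq> \<nu> \<Longrightarrow> \<exists>h\<in>H. \<mu> h \<noteq> \<nu> h"
    and "\<And>\<mu> h. \<mu> \<in> \<Lambda> \<Longrightarrow> h \<in> H \<Longrightarrow> D h (v \<mu>) - scale (\<mu> h) (v \<mu>) \<in> I"
    and "sum v \<Lambda> \<in> I"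
    and "\<mu> \<in> \<Lambda>"
  shows "v \<mu> \<in> I"
  using assms(4-)
proof (induction \<Lambda> arbitrary: v \<mu> rule: finite_induct)
  case (insert \<nu> \<Lambda>)
  note sep = insert.prems(1) and weight = insert.prems(2) and sum = insert.prems(3)
  \<comment> \<open>The induction hypothesis is applied to the vectors rescaled by
    \<open>\<kappa> h - \<nu> h\<close>: each keeps its weight modulo \<open>I\<close>, and their
    sum over the smaller index set lies in \<open>I\<close>.\<close>
  have scaled: "scale (\<kappa> h - \<nu> h) (v \<kappa>) \<in> I" if "\<kappa> \<in> \<Lambda>" "h \<in> H" for \<kappa> h
  proof (rule insert.IH[where v = "\<lambda>\<kappa>. scale (\<kappa> h - \<nu> h) (v \<kappa>)"])
    interpret D: Vector_Spaces.linear scale scale "D h" by (rule lin) fact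
    \<comment> \<open>Apply \<open>D h\<close> minus the scalar \<open>\<nu> h\<close> to the whole
      sum, then subtract the eigenvector errors. What is left is the rescaled sum, whose term at
      \<open>\<nu>\<close> is zero.\<close>
    have "D h (sum v (insert \<nu> \<Lambda>)) - scale (\<nu> h) (sum v (insert \<nu> \<Lambda>))
        - (\<Sum>\<kappa>\<in>insert \<nu> \<Lambda>. D h (v \<kappa>) - scale (\<kappa> h) (v \<kappa>)) \<in> I"
      by (intro subspace_diff[OF I] inv[OF that(2) sum] subspace_scale[OF I sum] subspace_sum[OF I]
          weight that(2))
    also have "D h (sum v (insert \<nu> \<Lambda>)) - scale (\<nu> h) (sum v (insert \<nu> \<Lambda>))
        - (\<Sum>\<kappa>\<in>insert \<nu> \<Lambda>. D h (v \<kappa>) - scale (\<kappa> h) (v \<kappa>))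
        = (\<Sum>\<kappa>\<in>insert \<nu> \<Lambda>. scale (\<kappa> h - \<nu> h) (v \<kappa>))"
      unfolding D.sum scale_sum_right sum_subtractf[symmetric]
      by (rule sum.cong) (simp_all add: scale_left_diff_distrib)
    also have "\<dots> = (\<Sum>\<kappa>\<in>\<Lambda>. scale (\<kappa> h - \<nu> h) (v \<kappa>))"
      using insert.hyps by simp
    finally show "(\<Sum>\<kappa>\<in>\<Lambda>. scale (\<kappa> h - \<nu> h) (v \<kappa>)) \<in> I" .
  next
    fix \<kappa> g assume "\<kappa> \<in> \<Lambda>" "g \<in> H"
    interpret D: Vector_Spaces.linear scale scale "D g" by (rule lin) fact
    have "scale (\<kappa> h - \<nu> h) (D g (v \<kappa>) - scale (\<kappa> g) (v \<kappa>)) \<in> I"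
      using weight \<open>\<kappa> \<in> \<Lambda>\<close> \<open>g \<in> H\<close> by (intro subspace_scale[OF I]) auto
    then show "D g (scale (\<kappa> h - \<nu> h) (v \<kappa>)) - scale (\<kappa> g) (scale (\<kappa> h - \<nu> h) (v \<kappa>)) \<in> I"
      by (simp add: D.scale scale_right_diff_distrib mult.commute)
  qed (use sep that in auto)
  have rest: "v \<kappa> \<in> I" if \<kappa>: "\<kappa> \<in> \<Lambda>" for \<kappa>
  proof -
    obtain h where h: "h \<in> H" "\<kappa> h \<noteq> \<nu> h"
      using sep[of \<kappa> \<nu>] \<kappa> insert.hyps by auto
    then have "v \<kappa> = scale (inverse (\<kappa> h - \<nu> h)) (scale (\<kappa> h - \<nu> h) (v \<kappa>))"
      by simp
    then show ?thesis using subspace_scale[OF I scaled[OF \<kappa> h(1)]] by metis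
  qed
  have "sum v (insert \<nu> \<Lambda>) - sum v \<Lambda> \<in> I"
    by (intro subspace_diff[OF I sum] subspace_sum[OF I] rest)
  then have "v \<nu> \<in> I" using insert.hyps by simp
  then show ?case using rest insert.prems(4) by auto
qed simp

section \<open>Scalars and commutators in the free algebra\<close>

lemma const_mult_commute: "const c * p = p * const c"
proof (induction p rule: Poly_Mapping.update_induct)
  case (update p w a)
  \<comment> \<open>The induction rule supplies that \<open>w\<close> is not a key of
    \<open>p\<close>, so the update just adds a monomial.\<close>
  have "Poly_Mapping.update w a p = Poly_Mapping.single w a + p"
    using update(1) by (intro poly_mapping_eqI) (auto simp: lookup_update lookup_add lookup_single in_keys_iff)
  then show ?case
    using update(3) by (simp add: const_def distrib_left distrib_right mult_single mult.commute)
qed simp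

lemma vector_space_free_algebra: "vector_space (\<lambda>c p :: 'l fword \<Rightarrow>\<^sub>0 'f::field. const c * p)"
  by standard
    (simp_all add: const_def distrib_left distrib_right mult_single single_add flip: mult.assoc)

definition commutator :: "'a::ring \<Rightarrow> 'a \<Rightarrow> 'a"
  where "commutator a b = a * b - b * a"

text \<open>Scalars act through \<open>const c\<close>, which is central and can therefore be pulled
  out of both products.\<close>

lemma linear_commutator:
  "Vector_Spaces.linear (\<lambda>c. (*) (const c)) (\<lambda>c. (*) (const c)) (commutator (p :: 'l fword \<Rightarrow>\<^sub>0 'f::field))"
  unfolding Vector_Spaces.linear_iff commutator_def
  by (auto simp: vector_space_free_algebra algebra_simps)
    (metis const_mult_commute mult.assoc)

text \<open>The Jacobi identity, arranged so that \<open>h\<close> acts directly on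
  \<open>p\<close>, where an eigenvector relation for \<open>p\<close> can be used.\<close>

lemma commutator_jacobi:
  fixes h x p :: "'a::ring"
  shows "commutator h (commutator x p) = commutator x (commutator h p) - commutator (commutator x h) p"
  by (simp add: commutator_def algebra_simps)

section \<open>Calculation in U(L) through representatives modulo the defining ideal\<close>

context lie_algebra
begin

abbreviation "I \<equiv> env_ideal scale br UNIV"
abbreviation "U \<equiv> envL scale br"
abbreviation "cls \<equiv> env_class scale br UNIV"

lemma ideal_I: "ideal I (free_algebra UNIV)"
  by (rule ideal_env_ideal) auto

lemma I_mult: "p \<in> I \<Longrightarrow> q * p \<in> I" "p \<in> I \<Longrightarrow> p * q \<in> I"
  using ideal.I_l_closed[OF ideal_I, of p q] ideal.I_r_closed[OF ideal_I, of p q]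
  by (simp_all add: free_algebra_def)

lemma I_add: "p \<in> I \<Longrightarrow> q \<in> I \<Longrightarrow> p + q \<in> I" and I_zero: "0 \<in> I"
  using additive_subgroup.a_closed[OF ideal.axioms(1)[OF ideal_I], of p q]
    additive_subgroup.zero_closed[OF ideal.axioms(1)[OF ideal_I]]
  by (simp_all add: free_algebra_def)

lemma subspace_I: "module.subspace (\<lambda>c. (*) (const c)) I"
proof -
  interpret P: vector_space "\<lambda>c p :: 'l fword \<Rightarrow>\<^sub>0 'f. const c * p"
    by (rule vector_space_free_algebra)
  show ?thesis by (rule P.subspaceI) (auto intro: I_mult I_add I_zero)
qed

lemma I_minus: "p \<in> I \<Longrightarrow> q \<in> I \<Longrightarrow> p - q \<in> I"
  using I_add[of p "- 1 * q"] I_mult(1)[of q "- 1"] by simp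

text \<open>Two-sidedness of the ideal provides the invariance hypothesis of
  \<open>weight_vectors_independent_mod\<close>.\<close>

lemma I_commutator: "p \<in> I \<Longrightarrow> commutator q p \<in> I"
  unfolding commutator_def by (intro I_minus I_mult)

lemma I_bracket: "commutator (var a) (var b) - var (br a b) \<in> I"
proof -
  have "env_relations scale br UNIV \<subseteq> I"
    unfolding env_ideal_def by (intro ring.genideal_self ring_free_algebra) simp
  then show ?thesis unfolding env_relations_def commutator_def by blast
qed

lemma cls_eq_coset: "cls p = {i + p | i. i \<in> I}"
  unfolding env_class_def a_r_coset_def' free_algebra_def ring.simps by blast

text \<open>This turns equations in U(L) into membership in \<open>I\<close>, so that the later
  calculations take place in the free algebra.\<close>

lemma cls_eq_iff: "cls p = cls q \<longleftrightarrow> p - q \<in> I"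
proof
  assume "cls p = cls q"
  moreover have "p \<in> cls p" using I_zero by (force simp: cls_eq_coset)
  ultimately show "p - q \<in> I" by (auto simp: cls_eq_coset)
next
  assume pq: "p - q \<in> I"
  show "cls p = cls q"
  proof (intro equalityI subsetI)
    fix y assume "y \<in> cls p"
    then obtain i where i: "i \<in> I" "y = i + p" by (auto simp: cls_eq_coset)
    then have "y = (i + (p - q)) + q" "i + (p - q) \<in> I" using I_add[OF _ pq] by simp_all
    then show "y \<in> cls q" by (auto simp only: cls_eq_coset)
  next
    fix y assume "y \<in> cls q"
    then obtain i where i: "i \<in> I" "y = i + q" by (auto simp: cls_eq_coset)
    then have "y = (i - (p - q)) + p" "i - (p - q) \<in> I" using I_minus[OF _ pq] by simp_all
    then show "y \<in> cls p" by (auto simp only: cls_eq_coset)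
  qed
qed

lemma ring_U: "ring U"
  by (rule ring_env) auto

lemma carrier_U: "carrier U = range cls"
  by (auto simp: env_def FactRing_def A_RCOSETS_def' env_class_def)

lemma cls_ring_hom: "cls \<in> ring_hom (free_algebra UNIV) U"
  using ideal.rcos_ring_hom[OF ideal_I] by (simp add: env_class_def[abs_def] env_def)

lemma cls_add: "cls p \<oplus>\<^bsub>U\<^esub> cls q = cls (p + q)"
  and cls_mult: "cls p \<otimes>\<^bsub>U\<^esub> cls q = cls (p * q)"
  using ring_hom_add[OF cls_ring_hom, of p q] ring_hom_mult[OF cls_ring_hom, of p q]
  by (simp_all add: free_algebra_def)

lemma cls_zero: "\<zero>\<^bsub>U\<^esub> = cls 0"
  using ring_hom_zero[OF cls_ring_hom ring_free_algebra ring_U] by (simp add: free_algebra_def)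

lemma cls_minus: "cls p \<ominus>\<^bsub>U\<^esub> cls q = cls (p - q)"
proof -
  interpret R: ring U by (rule ring_U)
  have "cls (- q) = \<ominus>\<^bsub>U\<^esub> cls q"
    by (rule R.minus_equality[symmetric]) (auto simp: cls_add cls_zero carrier_U)
  then show ?thesis by (simp add: a_minus_def cls_add flip: \<open>cls (- q) = _\<close>)
qed

lemma env_ad_cls: "env_ad scale br a (cls p) = cls (commutator (var a) p)"
  by (simp add: env_ad_def env_emb_def cls_mult cls_minus commutator_def)

lemma env_scale_cls: "env_scale scale br c (cls p) = cls (const c * p)"
  by (simp add: env_scale_def cls_mult)

lemma finsum_cls:
  assumes "finite A" "\<And>a. a \<in> A \<Longrightarrow> v a = cls (f a)"
  shows "finsum U v A = cls (sum f A)"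
  using assms
proof (induction A rule: finite_induct)
  interpret R: ring U by (rule ring_U)
  case empty
  show ?case by (simp add: cls_zero)
next
  interpret R: ring U by (rule ring_U)
  case (insert a A)
  then show ?case by (subst R.finsum_insert) (auto simp: cls_add carrier_U)
qed

section \<open>Weight spaces of U(H) and the action of \<open>x\<close>\<close>

context
  fixes H :: "'l set" and x :: 'l
  assumes ideal: "lie_ideal scale br H"
begin

lemma weight_space_cls_iff:
  "cls p \<in> weight_space scale br H \<mu> \<longleftrightarrow>
    cls p \<in> env_sub scale br H \<and> (\<forall>h\<in>H. commutator (var h) p - const (\<mu> h) * p \<in> I)"
  by (simp add: weight_space_def env_ad_cls env_scale_cls cls_eq_iff)

lemma weight_space_reps:
  assumes "\<And>\<mu>. \<mu> \<in> \<Lambda> \<Longrightarrow> v \<mu> \<in> weight_space scale br H \<mu>"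
  obtains f where "\<And>\<mu>. \<mu> \<in> \<Lambda> \<Longrightarrow> v \<mu> = cls (f \<mu>)"
proof -
  have sub: "subspace H" and closed: "\<And>a b. a \<in> H \<Longrightarrow> b \<in> H \<Longrightarrow> br a b \<in> H"
    using ideal by (auto simp: lie_ideal_def)
  have "\<forall>\<mu>\<in>\<Lambda>. \<exists>p. v \<mu> = cls p"
    using assms by (fastforce simp: weight_space_def env_sub_eq[OF sub closed])
  then show ?thesis using that by (auto dest: bchoice)
qed

text \<open>By linearity ad x acts on a sum of weight vectors term by term, and each image stays in
  its weight space, so the same index set serves for the image.\<close>

lemma semi_center_stable_if:
  assumes "\<And>\<mu>. \<mu> \<in> linear_forms scale H \<Longrightarrow> ad_stable scale br x (weight_space scale br H \<mu>)"
  shows "ad_stable scale br x (semi_center scale br H)"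
  unfolding ad_stable_def
proof
  interpret X: Vector_Spaces.linear "\<lambda>c. (*) (const c)" "\<lambda>c. (*) (const c)"
    "commutator (var x) :: ('l fword \<Rightarrow>\<^sub>0 'f) \<Rightarrow> _" by (rule linear_commutator)
  fix w assume "w \<in> semi_center scale br H"
  then obtain v \<Lambda> where w: "w = finsum U v \<Lambda>" and \<Lambda>: "finite \<Lambda>" "\<Lambda> \<subseteq> linear_forms scale H"
    and v: "\<And>\<mu>. \<mu> \<in> \<Lambda> \<Longrightarrow> v \<mu> \<in> weight_space scale br H \<mu>"
    by (auto simp: semi_center_def)
  obtain f where f: "\<And>\<mu>. \<mu> \<in> \<Lambda> \<Longrightarrow> v \<mu> = cls (f \<mu>)"
    using weight_space_reps[OF v] by metis
  have "env_ad scale br x w = cls (\<Sum>\<mu>\<in>\<Lambda>. commutator (var x) (f \<mu>))"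
    by (simp add: w finsum_cls[OF \<Lambda>(1) f] env_ad_cls X.sum)
  also have "\<dots> = finsum U (\<lambda>\<mu>. env_ad scale br x (v \<mu>)) \<Lambda>"
    by (rule finsum_cls[symmetric]) (use \<Lambda> f in \<open>auto simp: env_ad_cls\<close>)
  finally show "env_ad scale br x w \<in> semi_center scale br H"
    using assms v \<Lambda> unfolding semi_center_def ad_stable_def by blast
qed

text \<open>Apply ad x to the relation for \<open>h\<close> and rearrange by Jacobi. Since
  \<open>H\<close> is an ideal, \<open>br x h\<close> lies in \<open>H\<close>, so the eigenvector
  relation for \<open>p\<close> is available there as well.\<close>

lemma commutator_weight_vector:
  assumes p: "\<And>h. h \<in> H \<Longrightarrow> commutator (var h) p - const (\<mu> h) * p \<in> I"
    and h: "h \<in> H"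
  shows "commutator (var h) (commutator (var x) p) - const (\<mu> h) * commutator (var x) p
    + const (\<mu> (br x h)) * p \<in> I"
proof -
  interpret X: Vector_Spaces.linear "\<lambda>c. (*) (const c)" "\<lambda>c. (*) (const c)"
    "commutator (var x) :: ('l fword \<Rightarrow>\<^sub>0 'f) \<Rightarrow> _" by (rule linear_commutator)
  \<comment> \<open>In the free algebra the commutator of \<open>var x\<close> and
    \<open>var h\<close> differs from \<open>var (br x h)\<close>; \<open>d\<close> is this error,
    which lies in \<open>I\<close>.\<close>
  define d :: "'l fword \<Rightarrow>\<^sub>0 'f" where "d = commutator (var x) (var h) - var (br x h)"
  have d: "d \<in> I" unfolding d_def by (rule I_bracket)
  have "br x h \<in> H" using ideal h by (auto simp: lie_ideal_def)
  then have "commutator (var x) (commutator (var h) p - const (\<mu> h) * p)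
      - (d * p - p * d) - (commutator (var (br x h)) p - const (\<mu> (br x h)) * p) \<in> I"
    by (intro I_minus I_commutator[OF p[OF h]] I_mult[OF d] p)
  also have "d * p - p * d = commutator (commutator (var x) (var h)) p - commutator (var (br x h)) p"
    by (simp add: d_def commutator_def[of _ p] algebra_simps)
  finally show ?thesis
    by (simp add: X.diff X.scale commutator_jacobi[of "var h" "var x" p] algebra_simps)
qed

lemma weight_space_stable_if:
  assumes stable: "ad_stable scale br x (semi_center scale br H)"
    and \<kappa>: "\<kappa> \<in> linear_forms scale H"
  shows "ad_stable scale br x (weight_space scale br H \<kappa>)"
  unfolding ad_stable_def
proof
  interpret P: vector_space "\<lambda>c p :: 'l fword \<Rightarrow>\<^sub>0 'f. const c * p"
    by (rule vector_space_free_algebra)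
  fix u assume u: "u \<in> weight_space scale br H \<kappa>"
  then obtain p where p: "u = cls p" using weight_space_reps[of "{\<kappa>}" "\<lambda>_. u"] by auto
  have p_eigen: "commutator (var h) p - const (\<kappa> h) * p \<in> I" if "h \<in> H" for h
    using u that by (simp add: p weight_space_cls_iff)
  define q where "q = commutator (var x) p"
  \<comment> \<open>A single weight vector is a one-term sum, which puts \<open>u\<close> into the
    semi-center.\<close>
  have "u = finsum U (\<lambda>_. u) {\<kappa>}"
    using finsum_cls[of "{\<kappa>}" "\<lambda>_. u" "\<lambda>_. p"] p by simp
  then have "u \<in> semi_center scale br H"
    unfolding semi_center_def using u \<kappa> by blast
  then have "cls q \<in> semi_center scale br H"
    using stable by (auto simp: ad_stable_def p env_ad_cls q_def)
  then obtain v \<Lambda> where q: "cls q = finsum U v \<Lambda>" and \<Lambda>: "finite \<Lambda>" "\<Lambda> \<subseteq> linear_forms scale H"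
    and v: "\<And>\<mu>. \<mu> \<in> \<Lambda> \<Longrightarrow> v \<mu> \<in> weight_space scale br H \<mu>"
    by (auto simp: semi_center_def)
  obtain f where f: "\<And>\<mu>. \<mu> \<in> \<Lambda> \<Longrightarrow> v \<mu> = cls (f \<mu>)"
    using weight_space_reps[OF v] by metis
  have f_eigen: "commutator (var h) (f \<mu>) - const (\<mu> h) * f \<mu> \<in> I" if "\<mu> \<in> \<Lambda>" "h \<in> H" for \<mu> h
    using v[OF that(1)] that by (simp add: f weight_space_cls_iff)
  have q_f: "q - sum f \<Lambda> \<in> I"
    using q by (simp add: finsum_cls[OF \<Lambda>(1) f] cls_eq_iff)
  \<comment> \<open>Elements of \<open>linear_forms\<close> are all \<open>undefined\<close> outside
    \<open>H\<close>, so distinct ones must differ at a point of \<open>H\<close>.\<close>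
  have sep: "\<exists>h\<in>H. \<mu> h \<noteq> \<nu> h"
    if "\<mu> \<in> linear_forms scale H" "\<nu> \<in> linear_forms scale H" "\<mu> \<noteq> \<nu>" for \<mu> \<nu>
    using that extensionalityI[of \<mu> H \<nu>] by (auto simp: linear_forms_def)
  have scaled: "const (\<mu> h - \<kappa> h) * f \<mu> \<in> I" if \<mu>: "\<mu> \<in> \<Lambda>" "\<mu> \<noteq> \<kappa>" and h: "h \<in> H" for \<mu> h
  proof -
    interpret D: Vector_Spaces.linear "\<lambda>c. (*) (const c)" "\<lambda>c. (*) (const c)"
      "commutator (var h) :: ('l fword \<Rightarrow>\<^sub>0 'f) \<Rightarrow> _" by (rule linear_commutator)
    \<comment> \<open>These are the weight components of the Jacobi relation with everything on one
      side. At \<open>\<kappa>\<close> the factor \<open>\<mu> h - \<kappa> h\<close> is zero, so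
      that slot is free for the multiple of \<open>p\<close>, which also has weight
      \<open>\<kappa>\<close>.\<close>
    define g where "g \<mu> = (if \<mu> = \<kappa> then const (\<kappa> (br x h)) * p else const (\<mu> h - \<kappa> h) * f \<mu>)" for \<mu>
    have "g \<mu> \<in> I"
    proof (rule P.weight_vectors_independent_mod[where H = H and D = "\<lambda>h. commutator (var h)"
          and \<Lambda> = "insert \<kappa> \<Lambda>" and v = g])
      fix \<mu> k assume *: "\<mu> \<in> insert \<kappa> \<Lambda>" "k \<in> H"
      interpret K: Vector_Spaces.linear "\<lambda>c. (*) (const c)" "\<lambda>c. (*) (const c)"
        "commutator (var k) :: ('l fword \<Rightarrow>\<^sub>0 'f) \<Rightarrow> _" by (rule linear_commutator)
      have scale_eigen: "commutator (var k) (const c * r) - const (\<mu> k) * (const c * r) \<in> I"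
        if "commutator (var k) r - const (\<mu> k) * r \<in> I" for c r
      proof -
        have "const c * (commutator (var k) r - const (\<mu> k) * r) \<in> I" using that by (rule I_mult)
        then show ?thesis
          by (simp add: K.scale right_diff_distrib mult.commute)
      qed
      show "commutator (var k) (g \<mu>) - const (\<mu> k) * g \<mu> \<in> I"
      proof (cases "\<mu> = \<kappa>")
        case True
        then show ?thesis using scale_eigen[of p] p_eigen *(2) by (simp only: g_def if_True simp_thms)
      next
        case False
        then show ?thesis using scale_eigen[of "f \<mu>"] f_eigen * by (simp only: g_def if_False) simp
      qed
    next
      show "\<exists>k\<in>H. \<mu> k \<noteq> \<nu> k"
        if "\<mu> \<in> insert \<kappa> \<Lambda>" "\<nu> \<in> insert \<kappa> \<Lambda>" "\<mu> \<noteq> \<nu>" for \<mu> \<nu>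
        using that \<Lambda>(2) \<kappa> by (intro sep) auto
    next
      have "sum g (insert \<kappa> \<Lambda>) = const (\<kappa> (br x h)) * p + sum g (\<Lambda> - {\<kappa>})"
        using \<Lambda>(1) by (simp add: sum.insert_remove g_def)
      \<comment> \<open>The added index contributes zero, so the formula holds whether or not
        \<open>\<kappa>\<close> belongs to \<open>\<Lambda>\<close>.\<close>
      also have "sum g (\<Lambda> - {\<kappa>}) = (\<Sum>\<mu>\<in>\<Lambda>. const (\<mu> h - \<kappa> h) * f \<mu>)"
        using \<Lambda>(1) by (intro sum.mono_neutral_cong_left) (auto simp: g_def)
      also have "\<dots> = (\<Sum>\<mu>\<in>\<Lambda>. const (\<mu> h) * f \<mu>) - const (\<kappa> h) * sum f \<Lambda>"
        by (simp add: P.scale_left_diff_distrib sum_subtractf sum_distrib_left)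
      finally have sum_g: "sum g (insert \<kappa> \<Lambda>) = const (\<kappa> (br x h)) * p
          + (\<Sum>\<mu>\<in>\<Lambda>. const (\<mu> h) * f \<mu>) - const (\<kappa> h) * sum f \<Lambda>" by simp
      \<comment> \<open>Three elements of \<open>I\<close> are combined: the first is the Jacobi
        relation for \<open>q\<close>, the second replaces \<open>q\<close> by
        \<open>sum f \<Lambda>\<close>, and the third replaces each commutator with
        \<open>f \<mu>\<close> by its scalar multiple.\<close>
      have "commutator (var h) q - const (\<kappa> h) * q + const (\<kappa> (br x h)) * p
          - (commutator (var h) (q - sum f \<Lambda>) - const (\<kappa> h) * (q - sum f \<Lambda>))
          - (\<Sum>\<mu>\<in>\<Lambda>. commutator (var h) (f \<mu>) - const (\<mu> h) * f \<mu>) \<in> I"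
        by (intro I_minus commutator_weight_vector[OF p_eigen h, folded q_def] I_commutator[OF q_f]
            I_mult(1)[OF q_f] P.subspace_sum[OF subspace_I] f_eigen h)
      also have "commutator (var h) q - const (\<kappa> h) * q + const (\<kappa> (br x h)) * p
          - (commutator (var h) (q - sum f \<Lambda>) - const (\<kappa> h) * (q - sum f \<Lambda>))
          - (\<Sum>\<mu>\<in>\<Lambda>. commutator (var h) (f \<mu>) - const (\<mu> h) * f \<mu>) = sum g (insert \<kappa> \<Lambda>)"
        by (simp add: sum_g D.diff D.sum sum_subtractf right_diff_distrib)
      finally show "sum g (insert \<kappa> \<Lambda>) \<in> I" .
    qed (use subspace_I linear_commutator I_commutator \<Lambda> \<mu> in auto)
    then show ?thesis using \<mu> by (simp add: g_def)
  qed
  have "f \<mu> \<in> I" if \<mu>: "\<mu> \<in> \<Lambda> - {\<kappa>}" for \<mu>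
  proof -
    \<comment> \<open>At an \<open>h\<close> separating \<open>\<mu>\<close> from
      \<open>\<kappa>\<close> the scalar in \<open>scaled\<close> is invertible and can be
      cancelled.\<close>
    obtain h where h: "h \<in> H" "\<mu> h \<noteq> \<kappa> h" using sep[of \<mu> \<kappa>] \<mu> \<kappa> \<Lambda> by auto
    then have "f \<mu> = const (inverse (\<mu> h - \<kappa> h)) * (const (\<mu> h - \<kappa> h) * f \<mu>)"
      by (simp only: P.scale_scale) simp
    moreover have "const (\<mu> h - \<kappa> h) * f \<mu> \<in> I" using \<mu> h(1) by (intro scaled) auto
    ultimately show ?thesis using I_mult(1) by metis
  qed
  then have rest: "sum f (\<Lambda> - {\<kappa>}) \<in> I" by (rule P.subspace_sum[OF subspace_I])
  have "cls q \<in> weight_space scale br H \<kappa>"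
  \<comment> \<open>Modulo \<open>I\<close>, only a possible \<open>\<kappa>\<close> component of
    \<open>q\<close> survives. If it is present, membership in U(H) comes from
    \<open>v \<kappa>\<close>; otherwise the class is zero, represented by 0 in the free algebra on
    \<open>H\<close>.\<close>
  proof (cases "\<kappa> \<in> \<Lambda>")
    case True
    then have "q - f \<kappa> \<in> I"
      using I_add[OF q_f rest] \<Lambda>(1) by (simp add: sum.remove)
    then have "cls q = v \<kappa>" using f True by (simp add: cls_eq_iff)
    then show ?thesis using v True by simp
  next
    case False
    then have "cls q = cls 0"
      using I_add[OF q_f rest] by (simp add: cls_eq_iff)
    moreover have "0 \<in> carrier (free_algebra H)" by (simp add: free_algebra_def)
    ultimately have "cls q \<in> env_sub scale br H"
      using env_sub_eq[of H] ideal by (auto simp: lie_ideal_def)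
    then show ?thesis
      unfolding \<open>cls q = cls 0\<close> weight_space_cls_iff by (simp add: commutator_def I_zero)
  qed
  then show "env_ad scale br x u \<in> weight_space scale br H \<kappa>"
    by (simp add: p env_ad_cls q_def)
qed

end

end

theorem theorem2p7:
  fixes scale :: "'f::field \<Rightarrow> 'l::ab_group_add \<Rightarrow> 'l"
    and br :: "'l \<Rightarrow> 'l \<Rightarrow> 'l"
    and x :: 'l
    and H :: "'l set"
  assumes "lie_algebra scale br"
    and "\<exists>B. finite_dimensional_vector_space scale B"
    and "lie_ideal scale br H"
    and "UNIV = {scale c x + h | c h. h \<in> H}"
  shows "ad_stable scale br x (semi_center scale br H) \<longleftrightarrow>
    (\<forall>\<mu>\<in>linear_forms scale H. ad_stable scale br x (weight_space scale br H \<mu>))"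
proof -
  interpret lie_algebra scale br by fact
  show ?thesis
    using semi_center_stable_if[OF assms(3)] weight_space_stable_if[OF assms(3)] by blast
qed

end
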